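(* For every $a>1$, every $\sigma>0$ and every $n\in\mathbb{Z}$, the operator $\mathcal{M}_n: X_1\to X_1'$ does not have zero as an eigenvalue, nor any purely imaginary eigenvalue. That is, if $\mu\in\mathbb{C}$ is zero or purely imaginary and $g\in X_1$ satisfies $(\mathcal{M}_n g)(f)=\mu\,(g,f)_{X_0^a}$ for all $f\in X_1$, then $g=0$.
   Context: All functions are complex-valued functions of $\phi\in(0,\pi)$. Fix $a>1$, $\sigma>0$. The space $X_1$ is the Hilbert space of all $g\in L^1_{\mathrm{loc}}(0,\pi)$ (with weak derivative $g'$) such that $$\|g\|_{X_1}^2=\int_0^\pi\Big(|g'(\phi)|^2+\frac{|g(\phi)|^2}{\sin^2\phi}\Big)\sin\phi\,d\phi<\infty .$$ $X_1'$ is its dual (functionals on $X_1$ are taken conjugate-linear in the argument $f$). The weighted inner product is $$(g,f)_{X_0^a}=\int_0^\pi g(\phi)\overline{f(\phi)}\,(a-\cos\phi)^2\sin\phi\,d\phi .$$ Let $\tilde U_\tau(\phi)=2\Big(\frac{a^2-1}{(a-\cos\phi)^2}-1\Big)$ and $\tilde U_\phi(\phi)=-\frac{2\sin\phi}{a-\cos\phi}$. As a differential operator, $\mathcal{M}_n=A_n+E_n$, where $$A_n g=((n\sigma)^2-in\sigma)g-\partial_\phi\Big(\frac1{\sin\phi}\partial_\phi(g\sin\phi)\Big),\qquad E_n g=in\sigma(\tilde U_\tau+2)g+\tilde U_\phi\,\partial_\phi g+\tilde U_\phi\cot\phi\, g .$$ It is realized as an operator $\mathcal{M}_n:X_1\to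 X_1'$ by: for $g,f\in X_1$, $$(\mathcal{M}_n g)(f)=\int_0^\pi \partial_\phi(g\sin\phi)\,\partial_\phi(\overline{f}\sin\phi)\,\frac{(a-\cos\phi)^2}{\sin\phi}\,d\phi+\Big((n\sigma)^2g+in\sigma(\tilde U_\tau+1)g,\;f\Big)_{X_0^a}.$$ A number $\mu\in\mathbb{C}$ is an eigenvalue of $\mathcal{M}_n$ if there is a nonzero $g\in X_1$ with $(\mathcal{M}_n g)(f)=\mu(g,f)_{X_0^a}$ for all $f\in X_1$. *)

theory Defs
  imports "HOL-Analysis.Analysis"
begin

text \<open>
  Functions on the interval from 0 to pi are represented by total functions of type
  \<^typ>\<open>real \<Rightarrow> complex\<close>; their values outside the open interval never matter, and
  functions that agree almost everywhere on it represent the same element.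
  The measure is the completed (Lebesgue) one, so representatives need not be Borel.
\<close>

abbreviation Ipi :: "real set" where
  "Ipi \<equiv> {0<..<pi}"

definition locally_integrable :: "(real \<Rightarrow> complex) \<Rightarrow> bool" where
  "locally_integrable g \<longleftrightarrow> (\<forall>K. compact K \<and> K \<subseteq> Ipi \<longrightarrow> set_integrable lebesgue K g)"

text \<open>Smoothness is expressed by the sequence \<open>D\<close> of all derivatives. The support is closed and
  contained in the bounded open interval, hence compact.\<close>

definition test_function :: "(real \<Rightarrow> complex) \<Rightarrow> bool" where
  "test_function \<psi> \<longleftrightarrow>
     (\<exists>D :: nat \<Rightarrow> real \<Rightarrow> complex. D 0 = \<psi> \<and>
        (\<forall>k x. (D k has_vector_derivative D (Suc k) x) (at x))) \<and>
     closure {x. \<psi> x \<noteq> 0} \<subseteq> Ipi"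

definition has_weak_derivative :: "(real \<Rightarrow> complex) \<Rightarrow> (real \<Rightarrow> complex) \<Rightarrow> bool" where
  "has_weak_derivative g h \<longleftrightarrow>
     locally_integrable g \<and> locally_integrable h \<and>
     (\<forall>\<psi>. test_function \<psi> \<longrightarrow>
        (LINT \<phi>:Ipi|lebesgue. g \<phi> * vector_derivative \<psi> (at \<phi>))
          = - (LINT \<phi>:Ipi|lebesgue. h \<phi> * \<psi> \<phi>))"

text \<open>A representative of the weak derivative, which is unique up to null sets if it exists.\<close>

definition weak_derivative :: "(real \<Rightarrow> complex) \<Rightarrow> real \<Rightarrow> complex" where
  "weak_derivative g = (SOME h. has_weak_derivative g h)"

text \<open>For measurable \<open>g\<close> and \<open>h\<close>, integrability of the nonnegative integrand below says exactly
  that the squared norm is finite.\<close>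

definition X1 :: "(real \<Rightarrow> complex) set" where
  "X1 = {g. locally_integrable g \<and>
     (\<exists>h. has_weak_derivative g h \<and>
        set_integrable lebesgue Ipi
          (\<lambda>\<phi>. ((cmod (h \<phi>))\<^sup>2 + (cmod (g \<phi>))\<^sup>2 / (sin \<phi>)\<^sup>2) * sin \<phi>))}"

definition inner_X0 :: "real \<Rightarrow> (real \<Rightarrow> complex) \<Rightarrow> (real \<Rightarrow> complex) \<Rightarrow> complex" where
  "inner_X0 a g f =
     (LINT \<phi>:Ipi|lebesgue. g \<phi> * cnj (f \<phi>) * of_real ((a - cos \<phi>)\<^sup>2 * sin \<phi>))"

definition U_tau :: "real \<Rightarrow> real \<Rightarrow> real" where
  "U_tau a \<phi> = 2 * ((a\<^sup>2 - 1) / (a - cos \<phi>)\<^sup>2 - 1)"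

text \<open>\<open>M_op a \<sigma> n g\<close> is the functional on \<open>X1\<close> (conjugate-linear in \<open>f\<close>) assigned to \<open>g\<close>, that
  is, the weak form of the differential operator with respect to \<open>inner_X0 a\<close>. In this form the
  first-order terms with coefficient \<open>- 2 sin \<phi> / (a - cos \<phi>)\<close> cancel against the derivative of
  the weight. For \<open>f\<close> and \<open>g\<close> in \<open>X1\<close> all integrands are absolutely integrable.\<close>

definition M_op :: "real \<Rightarrow> real \<Rightarrow> int \<Rightarrow> (real \<Rightarrow> complex) \<Rightarrow> (real \<Rightarrow> complex) \<Rightarrow> complex" where
  "M_op a \<sigma> n g f =
     (LINT \<phi>:Ipi|lebesgue.
        weak_derivative (\<lambda>x. g x * of_real (sin x)) \<phi> *
        weak_derivative (\<lambda>x. cnj (f x) * of_real (sin x)) \<phi> *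
        of_real ((a - cos \<phi>)\<^sup>2 / sin \<phi>))
     + inner_X0 a
         (\<lambda>\<phi>. of_real ((of_int n * \<sigma>)\<^sup>2) * g \<phi>
              + \<i> * of_real (of_int n * \<sigma> * (U_tau a \<phi> + 1)) * g \<phi>) f"

definition eigenvalue_M :: "real \<Rightarrow> real \<Rightarrow> int \<Rightarrow> complex \<Rightarrow> bool" where
  "eigenvalue_M a \<sigma> n \<mu> \<longleftrightarrow>
     (\<exists>g\<in>X1. \<not> (AE \<phi> in lebesgue. \<phi> \<in> Ipi \<longrightarrow> g \<phi> = 0) \<and>
        (\<forall>f\<in>X1. M_op a \<sigma> n g f = \<mu> * inner_X0 a g f))"

end

theory Submission
  imports Defs "HOL-Computational_Algebra.Polynomial"
begin

text \<open>
  Test the eigenvalue equation with \<open>f = g\<close> and take real parts. The right-hand side vanishes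
  because \<open>(g, g)\<close> is real and \<open>\<mu>\<close> is imaginary; on the left, the terms with the factor
  \<open>\<i>\<close> drop out and the rest is nonnegative. Hence the integral of
  \<open>|(g sin)'|\<^sup>2 (a - cos)\<^sup>2 / sin\<close> is zero, so \<open>g sin\<close> is almost everywhere a constant \<open>c\<close>.
  Since \<open>|g|\<^sup>2 / sin = |c|\<^sup>2 / sin\<^sup>3\<close> is integrable only for \<open>c = 0\<close>, it follows that \<open>g = 0\<close>.
\<close>

section \<open>Smooth functions\<close>

text \<open>For \<open>n = 0\<close> the zeroth-order term has zero real part on the diagonal, so
  definiteness has to come from the derivative term alone. Its kernel, the multiples of
  \<open>1 / sin\<close>, is excluded only by the weight of the \<open>X1\<close> norm at the end
  points. The derivative term is written with \<open>weak_derivative\<close>, an arbitrary choice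
  among representatives, so evaluating it needs uniqueness of weak derivatives; and passing from a
  vanishing weak derivative to a constant needs primitives of test functions. Both rest on the
  fundamental lemma of the calculus of variations, hence on a supply of bump functions that are
  smooth in the sense of \<open>test_function\<close>.\<close>

primrec times_differentiable :: "nat \<Rightarrow> (real \<Rightarrow> complex) \<Rightarrow> bool" where
  "times_differentiable 0 f \<longleftrightarrow> True"
| "times_differentiable (Suc n) f \<longleftrightarrow>
     (\<exists>f'. (\<forall>x. (f has_vector_derivative f' x) (at x)) \<and> times_differentiable n f')"

definition smooth :: "(real \<Rightarrow> complex) \<Rightarrow> bool" where
  "smooth f \<longleftrightarrow> (\<forall>n. times_differentiable n f)"

abbreviation derivative :: "(real \<Rightarrow> complex) \<Rightarrow> real \<Rightarrow> complex" where
  "derivative f \<equiv> (\<lambda>x. vector_derivative f (at x))"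

lemma derivative_eqI:
  assumes "\<And>x. (f has_vector_derivative f' x) (at x)"
  shows "derivative f = f'"
  using assms by (auto simp: vector_derivative_at)

lemma times_differentiable_SucD: "times_differentiable (Suc n) f \<Longrightarrow> times_differentiable n f"
  by (induction n arbitrary: f) auto

lemma smooth_has_derivative:
  assumes "smooth f"
  shows "(f has_vector_derivative derivative f x) (at x)"
proof -
  have "times_differentiable (Suc 0) f"
    using assms by (auto simp: smooth_def simp del: times_differentiable.simps)
  then obtain f' where "(f has_vector_derivative f' x) (at x)"
    by auto
  then show ?thesis
    by (simp add: vector_derivative_at)
qed

lemma smooth_derivative:
  assumes "smooth f"
  shows "smooth (derivative f)"
  unfolding smooth_def
proof
  fix n
  have "times_differentiable (Suc n) f"
    using assms by (auto simp: smooth_def simp del: times_differentiable.simps)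
  then show "times_differentiable n (derivative f)"
    using derivative_eqI by force
qed

lemma smoothI_derivative:
  assumes "\<And>x. (f has_vector_derivative f' x) (at x)" "smooth f'"
  shows "smooth f"
  unfolding smooth_def
proof
  fix n
  show "times_differentiable n f"
    using assms by (cases n) (auto simp: smooth_def)
qed

text \<open>Bridge to the encoding inside \<open>test_function\<close>. The recursive form suits
  closure proofs: one use of the product rule per induction step, where an explicit sequence
  \<open>D\<close> for a product would need the Leibniz formula at every order.\<close>

lemma smooth_iff_sequence:
  "smooth f \<longleftrightarrow> (\<exists>D :: nat \<Rightarrow> real \<Rightarrow> complex. D 0 = f \<and>
     (\<forall>k x. (D k has_vector_derivative D (Suc k) x) (at x)))" (is "_ \<longleftrightarrow> ?R")
proof
  assume f: "smooth f"
  have s: "smooth ((derivative ^^ k) f)" for k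
    by (induction k) (auto simp: f smooth_derivative)
  show ?R
    by (rule exI[of _ "\<lambda>k. (derivative ^^ k) f"]) (use s smooth_has_derivative in auto)
next
  assume ?R
  then obtain D where D: "D 0 = f" "\<And>k x. (D k has_vector_derivative D (Suc k) x) (at x)"
    by blast
  have "times_differentiable n (D k)" for n k
    by (induction n arbitrary: k) (use D in auto)
  with D(1) show "smooth f"
    by (auto simp: smooth_def)
qed

lemma smooth_continuous: "smooth f \<Longrightarrow> continuous_on A f"
  by (meson continuous_at_imp_continuous_on has_vector_derivative_continuous smooth_has_derivative)

section \<open>Closure properties of smooth functions\<close>

lemma times_differentiable_add:
  "times_differentiable n f \<Longrightarrow> times_differentiable n g \<Longrightarrow> times_differentiable n (\<lambda>x. f x + g x)"
proof (induction n arbitrary: f g)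
  case (Suc n)
  then obtain f' g' where
    "\<And>x. (f has_vector_derivative f' x) (at x)" "times_differentiable n f'"
    "\<And>x. (g has_vector_derivative g' x) (at x)" "times_differentiable n g'"
    by auto
  with Suc.IH show ?case
    by (auto intro!: exI[of _ "\<lambda>x. f' x + g' x"] has_vector_derivative_add)
qed simp

lemma times_differentiable_mult:
  "times_differentiable n f \<Longrightarrow> times_differentiable n g \<Longrightarrow> times_differentiable n (\<lambda>x. f x * g x)"
proof (induction n arbitrary: f g)
  case (Suc n)
  then obtain f' g' where
    "\<And>x. (f has_vector_derivative f' x) (at x)" "times_differentiable n f'"
    "\<And>x. (g has_vector_derivative g' x) (at x)" "times_differentiable n g'"
    by auto
  \<comment> \<open>The product rule leaves one factor undifferentiated in each summand, so the
    factors themselves are needed at order \<open>n\<close> as well.\<close>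
  moreover have "times_differentiable n f" "times_differentiable n g"
    using Suc.prems times_differentiable_SucD by blast+
  ultimately have "times_differentiable n (\<lambda>x. f x * g' x + f' x * g x)"
    "\<And>x. ((\<lambda>x. f x * g x) has_vector_derivative f x * g' x + f' x * g x) (at x)"
    by (auto intro!: times_differentiable_add Suc.IH has_vector_derivative_mult)
  then show ?case
    by (auto intro!: exI[of _ "\<lambda>x. f x * g' x + f' x * g x"])
qed simp

lemma smooth_const [simp]: "smooth (\<lambda>_. c)"
  unfolding smooth_iff_sequence
  by (rule exI[of _ "\<lambda>k x. if k = 0 then c else 0"]) auto

lemma smooth_add: "smooth f \<Longrightarrow> smooth g \<Longrightarrow> smooth (\<lambda>x. f x + g x)"
  by (simp add: smooth_def times_differentiable_add)

lemma smooth_mult: "smooth f \<Longrightarrow> smooth g \<Longrightarrow> smooth (\<lambda>x. f x * g x)"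
  by (simp add: smooth_def times_differentiable_mult)

lemma smooth_cnj:
  assumes "smooth f"
  shows "smooth (\<lambda>x. cnj (f x))"
proof -
  have "times_differentiable n f \<Longrightarrow> times_differentiable n (\<lambda>x. cnj (f x))" for n and f :: "real \<Rightarrow> complex"
  proof (induction n arbitrary: f)
    case (Suc n)
    then obtain f' where
      "\<And>x. (f has_vector_derivative f' x) (at x)" "times_differentiable n f'"
      by auto
    with Suc.IH show ?case
      by (auto intro!: exI[of _ "\<lambda>x. cnj (f' x)"] has_vector_derivative_cnj)
  qed simp
  with assms show ?thesis
    by (simp add: smooth_def)
qed

lemma smooth_affine:
  assumes "smooth f"
  shows "smooth (\<lambda>x. f (p * x + q))"
proof -
  have "times_differentiable n f \<Longrightarrow> times_differentiable n (\<lambda>x. f (p * x + q))" for n and f :: "real \<Rightarrow> complex"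
  proof (induction n arbitrary: f)
    case (Suc n)
    then obtain f' where f': "\<And>x. (f has_vector_derivative f' x) (at x)" "times_differentiable n f'"
      by auto
    have "((\<lambda>x. f (p * x + q)) has_vector_derivative of_real p * f' (p * x + q)) (at x)" for x
    proof -
      have "((\<lambda>x. p * x + q) has_vector_derivative p) (at x)"
        by (auto intro!: derivative_eq_intros simp flip: has_real_derivative_iff_has_vector_derivative)
      from vector_diff_chain_at[OF this f'(1)] show ?thesis
        by (simp add: o_def scaleR_conv_of_real)
    qed
    moreover have "times_differentiable n (\<lambda>x. of_real p * f' (p * x + q))"
      using Suc.IH[OF f'(2)] smooth_const[of "of_real p"] times_differentiable_mult
      unfolding smooth_def by blast
    ultimately show ?case
      by (auto intro!: exI[of _ "\<lambda>x. of_real p * f' (p * x + q)"])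
  qed simp
  with assms show ?thesis
    by (simp add: smooth_def)
qed

text \<open>Differentiation shifts the phase by \<open>pi / 2\<close>, so the family of all shifted
  sines is closed under it and the induction can run over \<open>b\<close>, with no separate
  treatment of the cosine.\<close>

lemma smooth_sin_shift: "smooth (\<lambda>x. of_real (sin (x + b)))"
proof -
  have d: "((\<lambda>x. complex_of_real (sin (x + b))) has_vector_derivative of_real (sin (x + (b + pi / 2)))) (at x)" for b x
  proof -
    have "((\<lambda>x. sin (x + b)) has_real_derivative sin (x + (b + pi / 2))) (at x)"
      by (auto intro!: derivative_eq_intros simp: sin_add cos_add)
    then show ?thesis
      by (rule has_vector_derivative_of_real)
  qed
  have "times_differentiable n (\<lambda>x. of_real (sin (x + b)))" for n b
  proof (induction n arbitrary: b)
    case (Suc n)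
    from Suc.IH d show ?case
      by (auto intro!: exI[of _ "\<lambda>x. of_real (sin (x + (b + pi / 2)))"])
  qed simp
  then show ?thesis
    by (simp add: smooth_def)
qed

lemma smooth_sin: "smooth (\<lambda>x. of_real (sin x))"
  using smooth_sin_shift[of 0] by simp

text \<open>The functions \<open>p(1/x) exp(-1/x)\<close> on the positive axis, extended by zero: this family is closed
  under differentiation, so all its members are smooth.\<close>

definition flat :: "real poly \<Rightarrow> real \<Rightarrow> real" where
  "flat p x = (if x > 0 then poly p (inverse x) * exp (- inverse x) else 0)"

lemma poly_times_exp_minus_tendsto_0:
  "((\<lambda>t::real. poly p t * exp (- t)) \<longlongrightarrow> 0) at_top"
proof -
  have "((\<lambda>t::real. \<Sum>i\<le>degree p. coeff p i * (t ^ i / exp t)) \<longlongrightarrow> (\<Sum>i\<le>degree p. coeff p i * 0)) at_top"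
    by (intro tendsto_intros tendsto_power_div_exp_0)
  then show ?thesis
    by (simp add: poly_altdef exp_minus divide_inverse sum_distrib_right mult.assoc)
qed

text \<open>With \<open>t = inverse x\<close>, the chain rule factor is \<open>- t^2\<close> and the
  derivative of \<open>p(t) exp(-t)\<close> is \<open>(p' - p)(t) exp(-t)\<close>; this gives the
  polynomial \<open>t^2 (p - p')\<close>. At the origin both sides are 0 because the exponential
  beats every polynomial.\<close>

lemma flat_has_derivative:
  "(flat p has_real_derivative flat (monom 1 2 * (p - pderiv p)) x) (at x)"
proof (cases x "0 :: real" rule: linorder_cases)
  case less
  have "((\<lambda>_. 0) has_real_derivative 0) (at x)"
    by simp
  then have "(flat p has_real_derivative 0) (at x)"
    by (rule has_field_derivative_transform_within_open[where S="{..<0}"]) (use less in \<open>auto simp: flat_def\<close>)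
  with less show ?thesis
    by (simp add: flat_def)
next
  case greater
  have "((\<lambda>x. poly p (inverse x) * exp (- inverse x)) has_real_derivative
      poly (monom 1 2 * (p - pderiv p)) (inverse x) * exp (- inverse x)) (at x)"
    using greater
    by (auto intro!: derivative_eq_intros simp: poly_monom power2_eq_square algebra_simps)
  then have "(flat p has_real_derivative
      poly (monom 1 2 * (p - pderiv p)) (inverse x) * exp (- inverse x)) (at x)"
    by (rule has_field_derivative_transform_within_open[where S="{0<..}"]) (use greater in \<open>auto simp: flat_def\<close>)
  with greater show ?thesis
    by (simp add: flat_def)
next
  case equal
  \<comment> \<open>The difference quotient at 0 is \<open>flat p h / h\<close>; dividing by
    \<open>h\<close> multiplies by \<open>t = inverse h\<close>, and \<open>pCons 0 p\<close> is the
    polynomial \<open>t p(t)\<close>.\<close>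
  have "((\<lambda>h. poly (pCons 0 p) (inverse h) * exp (- inverse h)) \<longlongrightarrow> 0) (at_right (0::real))"
    by (rule filterlim_compose[OF poly_times_exp_minus_tendsto_0 filterlim_inverse_at_top_right])
  moreover have "eventually (\<lambda>h. poly (pCons 0 p) (inverse h) * exp (- inverse h) = flat p h / h) (at_right 0)"
    by (auto simp: eventually_at_filter flat_def divide_inverse)
  ultimately have "((\<lambda>h. flat p h / h) \<longlongrightarrow> 0) (at_right 0)"
    by (rule Lim_transform_eventually)
  moreover have "eventually (\<lambda>h. 0 = flat p h / h) (at_left 0)"
    by (auto simp: eventually_at_filter flat_def)
  then have "((\<lambda>h. flat p h / h) \<longlongrightarrow> 0) (at_left 0)"
    by (rule Lim_transform_eventually[OF tendsto_const])
  ultimately have "((\<lambda>h. flat p h / h) \<longlongrightarrow> 0) (at 0)"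
    by (simp add: filterlim_split_at)
  then show ?thesis
    using equal by (simp add: has_field_derivative_iff flat_def)
qed

lemma smooth_flat: "smooth (\<lambda>x. of_real (flat p x))"
proof -
  have d: "((\<lambda>x. complex_of_real (flat p x)) has_vector_derivative
      of_real (flat (monom 1 2 * (p - pderiv p)) x)) (at x)" for p x
    by (intro has_vector_derivative_of_real flat_has_derivative)
  have "times_differentiable n (\<lambda>x. of_real (flat p x))" for n p
  proof (induction n arbitrary: p)
    case (Suc n)
    from Suc.IH d show ?case
      by (auto intro!: exI[of _ "\<lambda>x. of_real (flat (monom 1 2 * (p - pderiv p)) x)"])
  qed simp
  then show ?thesis
    by (simp add: smooth_def)
qed

lemma flat_1: "flat 1 x = (if x > 0 then exp (- inverse x) else 0)"
  by (simp add: flat_def)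

section \<open>Test functions and their supports\<close>

lemma test_function_iff: "test_function \<psi> \<longleftrightarrow> smooth \<psi> \<and> closure {x. \<psi> x \<noteq> 0} \<subseteq> Ipi"
  by (simp add: test_function_def smooth_iff_sequence)

lemma test_functionI:
  assumes "smooth \<psi>" "0 < c" "d < pi" "\<And>x. x \<notin> {c..d} \<Longrightarrow> \<psi> x = 0"
  shows "test_function \<psi>"
proof -
  have "closure {x. \<psi> x \<noteq> 0} \<subseteq> {c..d}"
    using assms(4) by (intro closure_minimal) (blast, simp)
  with assms show ?thesis
    unfolding test_function_iff by auto
qed

lemma test_functionE:
  assumes "test_function \<psi>"
  obtains c d where "smooth \<psi>" "0 < c" "c \<le> d" "d < pi" "\<And>x. x \<notin> {c..d} \<Longrightarrow> \<psi> x = 0"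
proof (cases "closure {x. \<psi> x \<noteq> 0} = {}")
  case True
  then have "\<psi> x = 0" for x by simp
  with assms show ?thesis
    \<comment> \<open>The zero function has no extreme points of support, so any interval inside
      \<open>Ipi\<close> serves; the one-point interval at 1 is taken.\<close>
    using that[of 1 1] pi_gt3 by (auto simp: test_function_iff)
next
  case False
  let ?K = "closure {x. \<psi> x \<noteq> 0}"
  have K: "?K \<subseteq> Ipi" "smooth \<psi>"
    using assms by (auto simp: test_function_iff)
  have "compact ?K"
    using bounded_subset[OF _ K(1)] by (simp add: compact_eq_bounded_closed)
  from compact_attains_inf[OF this False] obtain c where c: "c \<in> ?K" "\<forall>x\<in>?K. c \<le> x" ..
  from compact_attains_sup[OF \<open>compact ?K\<close> False] obtain d where d: "d \<in> ?K" "\<forall>x\<in>?K. x \<le> d" ..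
  have "\<psi> x = 0" if "x \<notin> {c..d}" for x
  proof (rule ccontr)
    assume "\<psi> x \<noteq> 0"
    then have "x \<in> ?K" by (intro subsetD[OF closure_subset]) simp
    with c(2) d(2) have "c \<le> x" "x \<le> d" by simp_all
    with that show False by simp
  qed
  moreover have "0 < c" "c \<le> d" "d < pi"
    using c d K(1) by auto
  ultimately show ?thesis
    using that[of c d] K(2) by blast
qed

section \<open>The fundamental lemma of the calculus of variations\<close>

lemma set_integrable_mult_continuous:
  fixes k \<psi> :: "real \<Rightarrow> complex"
  assumes "set_integrable lebesgue K k" "compact K" "continuous_on K \<psi>"
  shows "set_integrable lebesgue K (\<lambda>x. k x * \<psi> x)"
proof -
  have K: "K \<in> sets lebesgue"
    using assms(2) by (simp add: compact_imp_closed)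
  have m: "\<psi> \<in> borel_measurable (lebesgue_on K)"
    by (rule continuous_imp_measurable_on_sets_lebesgue[OF assms(3) K])
  have b: "bounded (\<psi> ` K)"
    using assms by (intro compact_imp_bounded compact_continuous_image)
  have "bilinear ((*) :: complex \<Rightarrow> complex \<Rightarrow> complex)"
    unfolding bilinear_conv_bounded_bilinear by (rule bounded_bilinear_mult)
  from absolutely_integrable_bounded_measurable_product[OF this m K b assms(1)]
  have "set_integrable lebesgue K (\<lambda>x. \<psi> x * k x)" .
  then show ?thesis
    by (simp add: mult.commute)
qed

lemma locally_integrable_mult_continuous:
  assumes "locally_integrable k" "continuous_on Ipi \<psi>"
  shows "locally_integrable (\<lambda>x. k x * \<psi> x)"
  using assms continuous_on_subset
  unfolding locally_integrable_def by (blast intro: set_integrable_mult_continuous)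

lemma locally_integrable_add:
  "locally_integrable k \<Longrightarrow> locally_integrable l \<Longrightarrow> locally_integrable (\<lambda>x. k x + l x)"
  by (simp add: locally_integrable_def)

lemma locally_integrable_diff:
  "locally_integrable k \<Longrightarrow> locally_integrable l \<Longrightarrow> locally_integrable (\<lambda>x. k x - l x)"
  by (simp add: locally_integrable_def)

lemma locally_integrable_cnj:
  "locally_integrable k \<Longrightarrow> locally_integrable (\<lambda>x. cnj (k x))"
  unfolding locally_integrable_def set_integrable_def
  by (subst complex_integrable_cnj[symmetric]) simp

lemma locally_integrable_const: "locally_integrable (\<lambda>_. c)"
  unfolding locally_integrable_def
proof safe
  fix K :: "real set" assume "compact K"
  then show "set_integrable lebesgue K (\<lambda>_. c)"
    using absolutely_integrable_on_const lmeasurable_compact by blast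
qed

lemma set_integrable_mult_compact_support:
  assumes "locally_integrable k" "continuous_on UNIV \<psi>" "0 < c" "d < pi"
    and "\<And>x. x \<notin> {c..d} \<Longrightarrow> \<psi> x = 0"
  shows "set_integrable lebesgue Ipi (\<lambda>x. k x * \<psi> x)"
proof -
  have "{c..d} \<subseteq> Ipi"
    using assms by auto
  then have "set_integrable lebesgue {c..d} k"
    using assms(1) by (auto simp: locally_integrable_def)
  then have "set_integrable lebesgue {c..d} (\<lambda>x. k x * \<psi> x)"
    by (rule set_integrable_mult_continuous) (auto intro: continuous_on_subset[OF assms(2)])
  moreover have "indicator {c..d} x *\<^sub>R (k x * \<psi> x) = indicator Ipi x *\<^sub>R (k x * \<psi> x)" for x
    using assms(5) \<open>{c..d} \<subseteq> Ipi\<close> by (auto split: split_indicator)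
  ultimately show ?thesis
    by (simp add: set_integrable_def)
qed

lemma set_integrable_mult_test_function:
  assumes "locally_integrable k" "test_function \<psi>"
  shows "set_integrable lebesgue Ipi (\<lambda>x. k x * \<psi> x)"
  using assms(2)
  by (rule test_functionE) (blast intro: set_integrable_mult_compact_support[OF assms(1)] smooth_continuous)

lemma test_function_derivative:
  assumes "test_function \<psi>"
  shows "test_function (derivative \<psi>)"
proof -
  obtain c d where *: "smooth \<psi>" "0 < c" "c \<le> d" "d < pi" "\<And>x. x \<notin> {c..d} \<Longrightarrow> \<psi> x = 0"
    using test_functionE[OF assms] by blast
  show ?thesis
  proof (rule test_functionI[where c=c and d=d])
    fix x assume x: "x \<notin> {c..d}"
    have "((\<lambda>_. 0) has_vector_derivative (0::complex)) (at x)"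
      by simp
    then have "(\<psi> has_vector_derivative 0) (at x)"
      by (rule has_vector_derivative_transform_within_open[where S="- {c..d}"]) (use * x in auto)
    then show "derivative \<psi> x = 0"
      by (simp add: vector_derivative_at)
  qed (use * smooth_derivative in auto)
qed

section \<open>From vanishing integrals to vanishing almost everywhere\<close>

lemma sigma_finite_lebesgue: "sigma_finite_measure (lebesgue :: real measure)"
proof
  show "\<exists>A :: real set set. countable A \<and> A \<subseteq> sets lebesgue \<and> \<Union> A = space lebesgue \<and> (\<forall>a\<in>A. emeasure lebesgue a \<noteq> \<infinity>)"
  proof (intro exI[of _ "range (\<lambda>n::nat. {- real n..real n})"] conjI)
    have "\<exists>n::nat. x \<in> {- real n..real n}" for x
    proof -
      obtain n :: nat where "\<bar>x\<bar> \<le> real n"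
        using real_arch_simple by blast
      then show ?thesis
        by (intro exI[of _ n]) auto
    qed
    then show "\<Union> (range (\<lambda>n::nat. {- real n..real n})) = space lebesgue"
      by auto
  qed auto
qed

text \<open>The sets over which \<open>f\<close> integrates to 0 form a Dynkin system containing the
  open intervals, an intersection-stable generator of the Borel sets. A Lebesgue set differs from a
  Borel set by a null set, so all integrals vanish and \<open>f\<close>, as a density, is
  zero.\<close>

lemma AE_zero_if_interval_integrals_zero:
  fixes f :: "real \<Rightarrow> complex"
  assumes f: "integrable lebesgue f"
    and zero: "\<And>c d. (LINT x:{c<..<d}|lebesgue. f x) = 0"
  shows "AE x in lebesgue. f x = 0"
proof -
  have fi: "set_integrable lebesgue A f" if "A \<in> sets lebesgue" for A
    using integrable_mult_indicator[OF that f] by (simp add: set_integrable_def)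
  have sets: "sets (borel :: real measure) = sigma_sets UNIV (range (\<lambda>(c, d). {c<..<d}))"
    by (simp add: borel_eq_box box_real sets_measure_of image_def split_beta)
  have UNIV_eq: "(\<Union>n::nat. {- real n<..<real n}) = UNIV"
  proof -
    have "\<exists>n::nat. x \<in> {- real n<..<real n}" for x
    proof -
      obtain n :: nat where "\<bar>x\<bar> < real n"
        using reals_Archimedean2 by blast
      then show ?thesis
        by (intro exI[of _ n]) auto
    qed
    then show ?thesis
      by blast
  qed
  \<comment> \<open>Needed for complements in the Dynkin argument; the whole line is not itself a
    bounded interval but an increasing union of such.\<close>
  have total: "(LINT x:UNIV|lebesgue. f x) = 0"
  proof -
    have "(\<lambda>n::nat. LINT x:{- real n<..<real n}|lebesgue. f x) \<longlonglongrightarrow>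
        (LINT x:(\<Union>n::nat. {- real n<..<real n})|lebesgue. f x)"
      by (intro set_integral_cont_up) (auto intro!: fi incseq_SucI)
    then show ?thesis
      by (simp add: UNIV_eq zero LIMSEQ_const_iff)
  qed
  have borel: "(LINT x:A|lebesgue. f x) = 0" if "A \<in> sets borel" for A
  proof -
    have "Int_stable (range (\<lambda>(c, d). {c<..<d::real}))"
      by (auto simp: Int_stable_def intro!: image_eqI[of _ _ "(max _ _, min _ _)"])
    moreover have "range (\<lambda>(c, d). {c<..<d::real}) \<subseteq> Pow UNIV"
      by simp
    moreover have "A \<in> sigma_sets UNIV (range (\<lambda>(c, d). {c<..<d::real}))"
      using that sets by simp
    ultimately show ?thesis
    proof (induction rule: sigma_sets_induct_disjoint)
      case (compl A)
      then have A: "A \<in> sets lebesgue"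
        using sets by (simp add: sets_completionI_sets)
      have "(LINT x:UNIV|lebesgue. f x) = (LINT x:A|lebesgue. f x) + (LINT x:(UNIV - A)|lebesgue. f x)"
        using set_integral_Un[of A "UNIV - A" lebesgue f, OF _ fi fi] A by (auto simp: Compl_in_sets_lebesgue Compl_eq_Diff_UNIV[symmetric])
      with compl total show ?case
        by simp
    next
      case (union A)
      have A: "A i \<in> sets lebesgue" for i
      proof -
        have "A i \<in> sets borel"
          using union(2) unfolding sets by blast
        then show ?thesis
          by (simp add: sets_completionI_sets)
      qed
      have "(LINT x:(\<Union>i. A i)|lebesgue. f x) = (\<Sum>i. LINT x:A i|lebesgue. f x)"
        using union(1) A by (intro lebesgue_integral_countable_add fi) (auto simp: disjoint_family_on_def)
      with union show ?case
        by simp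
    next
      case empty
      show ?case
        by (simp add: set_lebesgue_integral_def)
    qed (auto simp: zero)
  qed
  show ?thesis
  proof (rule sigma_finite_measure.density_zero[OF sigma_finite_lebesgue f])
    fix A :: "real set" assume A: "A \<in> sets lebesgue"
    \<comment> \<open>Completion splits \<open>A\<close> into a Borel main part and a remainder
      inside the null set \<open>N\<close>, so the integral over \<open>A\<close> is one over a
      Borel set.\<close>
    obtain N where N: "N \<in> null_sets lborel" "null_part lborel A \<subseteq> N"
      using null_part[OF A] by blast
    have "AE x in lebesgue. x \<in> A \<longleftrightarrow> x \<in> main_part lborel A"
    proof (rule AE_I')
      show "N \<in> null_sets lebesgue"
        using N(1) by (rule null_sets_completionI)
    qed (use main_part_null_part_Un[OF A] N(2) in auto)
    then have "(LINT x:A|lebesgue. f x) = (LINT x:main_part lborel A|lebesgue. f x)"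
      using A f main_part_sets[OF A] unfolding set_lebesgue_integral_def
      by (intro integral_cong_AE borel_measurable_scaleR borel_measurable_indicator)
        (auto simp: sets_completionI_sets indicator_def)
    moreover have "main_part lborel A \<in> sets borel"
      using main_part_sets[OF A] by simp
    ultimately show "(LINT x:A|lebesgue. f x) = 0"
      using borel by simp
  qed
qed

text \<open>As \<open>m\<close> grows, the factor \<open>exp(-1/(m y))\<close> tends to 1 for every \<open>y > 0\<close>, so these test functions
  tend boundedly to the indicator of the open interval from \<open>c\<close> to \<open>d\<close>.\<close>

definition bump :: "real \<Rightarrow> real \<Rightarrow> nat \<Rightarrow> real \<Rightarrow> real" where
  "bump c d m x = flat 1 (real (Suc m) * (x - c)) * flat 1 (real (Suc m) * (d - x))"

lemma bump_outside: "x \<notin> {c<..<d} \<Longrightarrow> bump c d m x = 0"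
  by (auto simp: bump_def flat_1 zero_less_mult_iff)

lemma flat_1_bounds: "0 \<le> flat 1 x" "flat 1 x \<le> 1"
  by (auto simp: flat_1)

lemma bump_bounds: "0 \<le> bump c d m x" "bump c d m x \<le> 1"
  by (auto simp: bump_def flat_1_bounds intro: mult_le_one)

lemma test_function_bump:
  assumes "0 < c" "d < pi"
  shows "test_function (\<lambda>x. of_real (bump c d m x))"
proof (rule test_functionI[OF _ assms])
  have "smooth (\<lambda>x. of_real (flat 1 (real (Suc m) * x + - real (Suc m) * c)) *
      of_real (flat 1 (- real (Suc m) * x + real (Suc m) * d)))"
    by (intro smooth_mult smooth_affine[OF smooth_flat])
  then show "smooth (\<lambda>x. of_real (bump c d m x))"
    by (simp add: bump_def algebra_simps)
qed (auto intro!: bump_outside)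

lemma bump_tendsto: "(\<lambda>m. bump c d m x) \<longlonglongrightarrow> indicator {c<..<d} x"
proof (cases "x \<in> {c<..<d}")
  case True
  have *: "(\<lambda>m. flat 1 (real (Suc m) * y)) \<longlonglongrightarrow> 1" if "y > 0" for y
  proof -
    have "(\<lambda>m. inverse (real (Suc m)) * inverse y) \<longlonglongrightarrow> 0 * inverse y"
      by (rule tendsto_mult[OF LIMSEQ_inverse_real_of_nat tendsto_const])
    then have "(\<lambda>m. exp (- (inverse (real (Suc m)) * inverse y))) \<longlonglongrightarrow> exp (- (0 * inverse y))"
      by (rule tendsto_exp[OF tendsto_minus])
    with that show ?thesis
      by (simp add: flat_1 zero_less_mult_iff del: of_nat_Suc)
  qed
  have "(\<lambda>m. bump c d m x) \<longlonglongrightarrow> 1 * 1"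
    unfolding bump_def using True by (intro tendsto_mult *) auto
  with True show ?thesis
    by simp
qed (simp add: bump_outside)

text \<open>Dominated convergence along the bumps: they lie between 0 and 1 and vanish outside the
  interval, so \<open>|k|\<close> restricted to \<open>{c..d}\<close> dominates. It is integrable
  because this compact interval stays away from 0 and \<open>pi\<close>.\<close>

lemma interval_integral_zero:
  assumes k: "locally_integrable k" and cd: "0 < c" "d < pi"
    and zero: "\<And>\<psi>. test_function \<psi> \<Longrightarrow> (LINT x:Ipi|lebesgue. k x * \<psi> x) = 0"
  shows "(LINT x:{c<..<d}|lebesgue. k x) = 0"
proof -
  have sub: "{c..d} \<subseteq> Ipi"
    using cd by auto
  have K: "set_integrable lebesgue {c..d} k"
    using k sub by (auto simp: locally_integrable_def)
  then have dom: "integrable lebesgue (\<lambda>x. norm (indicator {c..d} x *\<^sub>R k x))"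
    unfolding set_integrable_def by (rule integrable_norm)
  from K have "set_integrable lebesgue {c<..<d} k"
    by (rule set_integrable_subset) auto
  then have meas: "(\<lambda>x. indicator {c<..<d} x *\<^sub>R k x) \<in> borel_measurable lebesgue"
    by (auto simp: set_integrable_def)
  have "(\<lambda>m. LINT x:Ipi|lebesgue. k x * of_real (bump c d m x)) \<longlonglongrightarrow> (LINT x:{c<..<d}|lebesgue. k x)"
    unfolding set_lebesgue_integral_def
  proof (rule integral_dominated_convergence[where w="\<lambda>x. norm (indicator {c..d} x *\<^sub>R k x)"])
    fix m
    show "(\<lambda>x. indicator Ipi x *\<^sub>R (k x * of_real (bump c d m x))) \<in> borel_measurable lebesgue"
      using set_integrable_mult_test_function[OF k test_function_bump[OF cd]]
      by (auto simp: set_integrable_def)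
    show "AE x in lebesgue. norm (indicator Ipi x *\<^sub>R (k x * of_real (bump c d m x))) \<le>
        norm (indicator {c..d} x *\<^sub>R k x)"
    proof (rule AE_I2)
      fix x
      have "norm (k x * of_real (bump c d m x)) \<le> norm (k x)"
        using bump_bounds[of c d m x] by (simp add: norm_mult mult_left_le)
      moreover have "bump c d m x = 0" if "x \<notin> {c..d}"
        using that by (intro bump_outside) auto
      ultimately show "norm (indicator Ipi x *\<^sub>R (k x * of_real (bump c d m x))) \<le>
        norm (indicator {c..d} x *\<^sub>R k x)"
        by (auto split: split_indicator)
    qed
    show "AE x in lebesgue. (\<lambda>m. indicator Ipi x *\<^sub>R (k x * of_real (bump c d m x))) \<longlonglongrightarrow>
        indicator {c<..<d} x *\<^sub>R k x"
    proof (rule AE_I2)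
      fix x
      have "(\<lambda>m. indicator Ipi x *\<^sub>R (k x * of_real (bump c d m x))) \<longlonglongrightarrow>
          indicator Ipi x *\<^sub>R (k x * of_real (indicator {c<..<d} x))"
        by (intro tendsto_intros bump_tendsto)
      also have "indicator Ipi x *\<^sub>R (k x * of_real (indicator {c<..<d} x)) = indicator {c<..<d} x *\<^sub>R k x"
        using cd by (auto split: split_indicator)
      finally show "(\<lambda>m. indicator Ipi x *\<^sub>R (k x * of_real (bump c d m x))) \<longlonglongrightarrow>
          indicator {c<..<d} x *\<^sub>R k x" .
    qed
  qed (fact meas dom)+
  then show ?thesis
    by (simp add: zero test_function_bump[OF cd] LIMSEQ_const_iff)
qed

lemma Ipi_exhaustion:
  assumes "x \<in> Ipi"
  obtains n where "x \<in> {inverse (real (Suc n))<..<pi - inverse (real (Suc n))}"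
proof -
  have "0 < min x (pi - x)"
    using assms by auto
  then obtain n where "inverse (real (Suc n)) < min x (pi - x)"
    using reals_Archimedean by blast
  then show ?thesis
    by (intro that[of n]) auto
qed

lemma AE_zero_if_test_integrals_zero:
  assumes k: "locally_integrable k"
    and zero: "\<And>\<psi>. test_function \<psi> \<Longrightarrow> (LINT x:Ipi|lebesgue. k x * \<psi> x) = 0"
  shows "AE x in lebesgue. x \<in> Ipi \<longrightarrow> k x = 0"
proof -
  \<comment> \<open>Near the end points \<open>k\<close> may fail to be integrable, so it is first
    cut off to an interval well inside; countably many such intervals then exhaust
    \<open>Ipi\<close>.\<close>
  have "AE x in lebesgue. x \<in> {p<..<q} \<longrightarrow> k x = 0" if pq: "0 < p" "q < pi" for p q
  proof -
    have "{p..q} \<subseteq> Ipi"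
      using pq by auto
    then have "set_integrable lebesgue {p..q} k"
      using k by (auto simp: locally_integrable_def)
    then have "set_integrable lebesgue {p<..<q} k"
      by (rule set_integrable_subset) auto
    then have "AE x in lebesgue. indicator {p<..<q} x *\<^sub>R k x = 0"
    proof (intro AE_zero_if_interval_integrals_zero)
      fix c d
      have "(LINT x:{c<..<d}|lebesgue. indicator {p<..<q} x *\<^sub>R k x) = (LINT x:{max c p<..<min d q}|lebesgue. k x)"
        unfolding set_lebesgue_integral_def by (intro Bochner_Integration.integral_cong) (auto split: split_indicator)
      also have "\<dots> = 0"
        using pq by (intro interval_integral_zero[OF k _ _ zero]) auto
      finally show "(LINT x:{c<..<d}|lebesgue. indicator {p<..<q} x *\<^sub>R k x) = 0" .
    qed (simp add: set_integrable_def)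
    then show ?thesis
      by eventually_elim (auto split: split_indicator_asm)
  qed
  then have "AE x in lebesgue. \<forall>n. x \<in> {inverse (real (Suc n))<..<pi - inverse (real (Suc n))} \<longrightarrow> k x = 0"
    unfolding AE_all_countable by auto
  then show ?thesis
    by eventually_elim (meson Ipi_exhaustion)
qed

section \<open>Weak derivatives\<close>

text \<open>Completeness of the measure passes measurability from \<open>f\<close> to
  \<open>g\<close>.\<close>

lemma set_integral_cong_AE_lebesgue:
  fixes f g :: "real \<Rightarrow> complex"
  assumes "set_integrable lebesgue A f" "AE x in lebesgue. x \<in> A \<longrightarrow> g x = f x"
  shows "(LINT x:A|lebesgue. g x) = (LINT x:A|lebesgue. f x)"
proof -
  have AE: "AE x in lebesgue. indicator A x *\<^sub>R f x = indicator A x *\<^sub>R g x"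
    using assms(2) by eventually_elim (auto split: split_indicator)
  have f: "(\<lambda>x. indicator A x *\<^sub>R f x) \<in> borel_measurable lebesgue"
    using assms(1) by (auto simp: set_integrable_def)
  from borel_measurable_AE[OF f AE] f AE show ?thesis
    unfolding set_lebesgue_integral_def by (intro integral_cong_AE) auto
qed

lemma has_weak_derivativeD:
  assumes "has_weak_derivative g h"
  shows "locally_integrable g" "locally_integrable h"
    and "test_function \<psi> \<Longrightarrow> (LINT x:Ipi|lebesgue. g x * derivative \<psi> x) = - (LINT x:Ipi|lebesgue. h x * \<psi> x)"
  using assms by (auto simp: has_weak_derivative_def)

lemma weak_derivative_unique:
  assumes "has_weak_derivative g h" "has_weak_derivative g h'"
  shows "AE x in lebesgue. x \<in> Ipi \<longrightarrow> h x = h' x"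
proof -
  note h = has_weak_derivativeD[OF assms(1)] and h' = has_weak_derivativeD[OF assms(2)]
  have "AE x in lebesgue. x \<in> Ipi \<longrightarrow> h x - h' x = 0"
  proof (rule AE_zero_if_test_integrals_zero)
    show "locally_integrable (\<lambda>x. h x - h' x)"
      by (intro locally_integrable_diff h h')
    fix \<psi> assume \<psi>: "test_function \<psi>"
    have "(LINT x:Ipi|lebesgue. (h x - h' x) * \<psi> x) =
        (LINT x:Ipi|lebesgue. h x * \<psi> x) - (LINT x:Ipi|lebesgue. h' x * \<psi> x)"
      using \<psi> by (simp add: left_diff_distrib set_integrable_mult_test_function h(2) h'(2))
    also have "\<dots> = 0"
      using h(3)[OF \<psi>] h'(3)[OF \<psi>] by simp
    finally show "(LINT x:Ipi|lebesgue. (h x - h' x) * \<psi> x) = 0" .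
  qed
  then show ?thesis
    by simp
qed

text \<open>Opens the choice hidden in \<open>weak_derivative\<close>: uniqueness lets any exhibited
  weak derivative stand in for the chosen one under an integral.\<close>

lemma weak_derivative_eq:
  assumes "has_weak_derivative g h"
  shows "AE x in lebesgue. x \<in> Ipi \<longrightarrow> weak_derivative g x = h x"
  unfolding weak_derivative_def
  by (rule weak_derivative_unique[OF someI[of "has_weak_derivative g", OF assms] assms])

lemma test_function_mult:
  assumes "smooth u" "test_function \<psi>"
  shows "test_function (\<lambda>x. u x * \<psi> x)"
proof -
  obtain c d where *: "smooth \<psi>" "0 < c" "c \<le> d" "d < pi" "\<And>x. x \<notin> {c..d} \<Longrightarrow> \<psi> x = 0"
    using test_functionE[OF assms(2)] by blast
  show ?thesis
    by (rule test_functionI[where c=c and d=d]) (use * assms(1) smooth_mult in auto)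
qed

lemma test_function_add:
  assumes "test_function \<phi>" "test_function \<psi>"
  shows "test_function (\<lambda>x. \<phi> x + \<psi> x)"
proof -
  obtain c d where 1: "smooth \<psi>" "0 < c" "c \<le> d" "d < pi" "\<And>x. x \<notin> {c..d} \<Longrightarrow> \<psi> x = 0"
    using test_functionE[OF assms(2)] by blast
  obtain c' d' where 2: "smooth \<phi>" "0 < c'" "c' \<le> d'" "d' < pi" "\<And>x. x \<notin> {c'..d'} \<Longrightarrow> \<phi> x = 0"
    using test_functionE[OF assms(1)] by blast
  show ?thesis
  proof (rule test_functionI[where c="min c c'" and d="max d d'"])
    show "smooth (\<lambda>x. \<phi> x + \<psi> x)"
      using 1 2 by (intro smooth_add)
    show "\<phi> x + \<psi> x = 0" if "x \<notin> {min c c'..max d d'}" for x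
      using that 1(5)[of x] 2(5)[of x] by (auto simp: min_le_iff_disj le_max_iff_disj)
  qed (use 1 2 in auto)
qed

lemma test_function_cnj:
  assumes "test_function \<psi>"
  shows "test_function (\<lambda>x. cnj (\<psi> x))"
  using assms smooth_cnj by (auto simp: test_function_iff)

text \<open>The factor \<open>u\<close> is moved onto the test function: \<open>u \<psi>\<close> is
  again a test function, and the ordinary product rule for it yields the extra term.\<close>

lemma has_weak_derivative_mult:
  assumes gh: "has_weak_derivative g h" and u: "smooth u"
  shows "has_weak_derivative (\<lambda>x. g x * u x) (\<lambda>x. h x * u x + g x * derivative u x)"
proof -
  note gh = has_weak_derivativeD[OF gh]
  have loc: "locally_integrable (\<lambda>x. g x * u x)" "locally_integrable (\<lambda>x. h x * u x)"
    "locally_integrable (\<lambda>x. g x * derivative u x)"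
    by (intro locally_integrable_mult_continuous gh smooth_continuous smooth_derivative u)+
  have "(LINT x:Ipi|lebesgue. g x * u x * derivative \<psi> x) =
      - (LINT x:Ipi|lebesgue. (h x * u x + g x * derivative u x) * \<psi> x)" if \<psi>: "test_function \<psi>" for \<psi>
  proof -
    have d: "vector_derivative (\<lambda>x. u x * \<psi> x) (at x) = u x * derivative \<psi> x + derivative u x * \<psi> x" for x
      using \<psi> u
      by (intro vector_derivative_at has_vector_derivative_mult smooth_has_derivative) (auto simp: test_function_iff)
    have i: "set_integrable lebesgue Ipi (\<lambda>x. g x * u x * derivative \<psi> x)"
      "set_integrable lebesgue Ipi (\<lambda>x. g x * derivative u x * \<psi> x)"
      "set_integrable lebesgue Ipi (\<lambda>x. h x * u x * \<psi> x)"
      by (intro set_integrable_mult_test_function loc test_function_derivative \<psi>)+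
    have "(LINT x:Ipi|lebesgue. g x * u x * derivative \<psi> x + g x * derivative u x * \<psi> x) =
        - (LINT x:Ipi|lebesgue. h x * u x * \<psi> x)"
      using gh(3)[OF test_function_mult[OF u \<psi>]] unfolding d by (simp add: distrib_left mult.assoc)
    then show ?thesis
      using i by (simp add: distrib_right eq_diff_eq)
  qed
  then show ?thesis
    unfolding has_weak_derivative_def using loc locally_integrable_add by blast
qed

lemma set_integral_cnj:
  "(LINT x:A|M. cnj (f x)) = cnj (LINT x:A|M. f x)"
proof -
  have "(LINT x|M. cnj (indicator A x *\<^sub>R f x)) = cnj (LINT x|M. indicator A x *\<^sub>R f x)"
    by (rule Bochner_Integration.integral_cnj)
  then show ?thesis
    by (simp add: set_lebesgue_integral_def)
qed

text \<open>The defining pairing carries no conjugation, so the equation for \<open>g\<close> is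
  tested with the conjugate of \<open>\<psi>\<close> and then conjugated as a whole.\<close>

lemma has_weak_derivative_cnj:
  assumes "has_weak_derivative g h"
  shows "has_weak_derivative (\<lambda>x. cnj (g x)) (\<lambda>x. cnj (h x))"
proof -
  note gh = has_weak_derivativeD[OF assms]
  have "(LINT x:Ipi|lebesgue. cnj (g x) * derivative \<psi> x) = - (LINT x:Ipi|lebesgue. cnj (h x) * \<psi> x)"
    if \<psi>: "test_function \<psi>" for \<psi>
  proof -
    have d: "vector_derivative (\<lambda>x. cnj (\<psi> x)) (at x) = cnj (derivative \<psi> x)" for x
      using \<psi> by (intro vector_derivative_at has_vector_derivative_cnj smooth_has_derivative) (auto simp: test_function_iff)
    have "cnj (LINT x:Ipi|lebesgue. g x * cnj (derivative \<psi> x)) = cnj (- (LINT x:Ipi|lebesgue. h x * cnj (\<psi> x)))"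
      using gh(3)[OF test_function_cnj[OF \<psi>]] by (simp add: d)
    then show ?thesis
      by (simp flip: set_integral_cnj)
  qed
  then show ?thesis
    using gh by (auto simp: has_weak_derivative_def locally_integrable_cnj)
qed

section \<open>Primitives of test functions and constancy\<close>

lemma test_function_integral_eq:
  assumes "test_function \<psi>"
  shows "(LINT x:Ipi|lebesgue. \<psi> x) = integral {0..pi} \<psi>"
proof -
  have "set_integrable lebesgue Ipi \<psi>"
    using set_integrable_mult_test_function[OF locally_integrable_const[of 1] assms] by simp
  then show ?thesis
    by (simp add: set_lebesgue_integral_eq_integral integral_open_interval_real)
qed

text \<open>The integral from 0 vanishes to the left of the support and equals the total integral to
  the right of it, so mean zero is exactly what makes its support compact in
  \<open>Ipi\<close>.\<close>

lemma test_function_primitive: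
  assumes "test_function \<theta>" and zero: "(LINT x:Ipi|lebesgue. \<theta> x) = 0"
  obtains \<zeta> where "test_function \<zeta>" "derivative \<zeta> = \<theta>"
proof -
  obtain c d where *: "smooth \<theta>" "0 < c" "c \<le> d" "d < pi" "\<And>x. x \<notin> {c..d} \<Longrightarrow> \<theta> x = 0"
    using test_functionE[OF assms(1)] by blast
  \<comment> \<open>A point strictly beyond \<open>d\<close>: on \<open>{e..x}\<close> the function
    \<open>\<theta>\<close> vanishes at every point including the left end, while
    \<open>\<theta> d\<close> is not directly known to be 0.\<close>
  define e where "e = (d + pi) / 2"
  have e: "d < e" "e < pi" "0 < e"
    using * by (auto simp: e_def)
  define \<zeta> where "\<zeta> x = integral {0..x} \<theta>" for x
  have cont: "continuous_on A \<theta>" for A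
    using *(1) by (rule smooth_continuous)
  have left: "\<zeta> x = 0" if "x < c" for x
  proof -
    have "integral {0..x} \<theta> = integral {0..x} (\<lambda>_. 0)"
      using that by (intro integral_cong *) auto
    then show ?thesis
      by (simp add: \<zeta>_def)
  qed
  have right: "\<zeta> x = \<zeta> e" if "e \<le> x" for x
  proof -
    have "integral {e..x} \<theta> = integral {e..x} (\<lambda>_. 0)"
      using that e by (intro integral_cong *) auto
    moreover have "integral {0..e} \<theta> + integral {e..x} \<theta> = integral {0..x} \<theta>"
      using that e by (intro Henstock_Kurzweil_Integration.integral_combine integrable_continuous_real cont) auto
    ultimately show ?thesis
      by (simp add: \<zeta>_def)
  qed
  have "\<zeta> pi = 0"
    using zero test_function_integral_eq[OF assms(1)] by (simp add: \<zeta>_def)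
  with right[of pi] e have "\<zeta> e = 0"
    by simp
  have deriv: "(\<zeta> has_vector_derivative \<theta> x) (at x)" for x
  \<comment> \<open>For negative \<open>x\<close> the interval \<open>{0..x}\<close> is empty and
    \<open>\<zeta>\<close> is 0 by convention, so the fundamental theorem of calculus is applied
    only where \<open>x\<close> is interior to \<open>{0..x + 1}\<close>.\<close>
  proof (cases "x < c")
    case True
    have "((\<lambda>_. 0) has_vector_derivative (0::complex)) (at x)"
      by simp
    then have "(\<zeta> has_vector_derivative 0) (at x)"
      by (rule has_vector_derivative_transform_within_open[where S="{..<c}"]) (use left True in auto)
    with True *(5)[of x] show ?thesis
      by simp
  next
    case False
    then have x: "x \<in> interior {0..x + 1}"
      using * by simp
    then have "(\<zeta> has_vector_derivative \<theta> x) (at x within {0..x + 1})"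
      unfolding \<zeta>_def by (intro integral_has_vector_derivative cont) auto
    then show ?thesis
      using at_within_interior[OF x] by simp
  qed
  show ?thesis
  proof
    show "test_function \<zeta>"
    proof (rule test_functionI)
      show "smooth \<zeta>"
        using deriv *(1) by (rule smoothI_derivative)
      show "\<zeta> x = 0" if "x \<notin> {c..e}" for x
        using that left right \<open>\<zeta> e = 0\<close> by (cases "x < c") auto
    qed (use * e in auto)
    show "derivative \<zeta> = \<theta>"
      using deriv by (rule derivative_eqI)
  qed
qed

lemma not_AE_zero_Ipi: "\<not> (AE x in lebesgue. x \<notin> Ipi)"
proof
  assume "AE x in lebesgue. x \<notin> Ipi"
  then have "emeasure lebesgue Ipi = 0"
    by (subst (asm) AE_iff_measurable[of Ipi]) (auto simp: greaterThanLessThan_def)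
  then show False
    by simp
qed

text \<open>Subtracting a multiple of a fixed test function \<open>\<rho>\<close> of nonzero integral makes any test function
  the derivative of another one. That such a \<open>\<rho>\<close> exists follows from the fundamental lemma, applied to
  the constant 1.\<close>

lemma constant_if_weak_derivative_zero:
  assumes G: "locally_integrable G"
    and zero: "\<And>\<psi>. test_function \<psi> \<Longrightarrow> (LINT x:Ipi|lebesgue. G x * derivative \<psi> x) = 0"
  obtains c where "AE x in lebesgue. x \<in> Ipi \<longrightarrow> G x = c"
proof -
  have "\<exists>\<rho>. test_function \<rho> \<and> (LINT x:Ipi|lebesgue. \<rho> x) \<noteq> 0"
  proof (rule ccontr)
    assume "\<not> ?thesis"
    then have "AE x in lebesgue. x \<in> Ipi \<longrightarrow> (1::complex) = 0"
      by (intro AE_zero_if_test_integrals_zero locally_integrable_const) auto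
    then show False
      using not_AE_zero_Ipi by simp
  qed
  then obtain \<rho> where \<rho>: "test_function \<rho>" "(LINT x:Ipi|lebesgue. \<rho> x) \<noteq> 0"
    by blast
  \<comment> \<open>The only candidate: if \<open>G\<close> is almost everywhere constant, pairing
    it with \<open>\<rho>\<close> recovers the constant.\<close>
  define c where "c = (LINT x:Ipi|lebesgue. G x * \<rho> x) / (LINT x:Ipi|lebesgue. \<rho> x)"
  have int1: "set_integrable lebesgue Ipi \<psi>" if "test_function \<psi>" for \<psi>
    using set_integrable_mult_test_function[OF locally_integrable_const[of 1] that] by simp
  have "AE x in lebesgue. x \<in> Ipi \<longrightarrow> G x - c = 0"
  proof (rule AE_zero_if_test_integrals_zero)
    show "locally_integrable (\<lambda>x. G x - c)"
      by (intro locally_integrable_diff G locally_integrable_const)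
    fix \<psi> assume \<psi>: "test_function \<psi>"
    define m where "m = (LINT x:Ipi|lebesgue. \<psi> x) / (LINT x:Ipi|lebesgue. \<rho> x)"
    have m\<rho>: "test_function (\<lambda>x. - m * \<rho> x)"
      by (rule test_function_mult[OF smooth_const \<rho>(1)])
    have \<theta>: "test_function (\<lambda>x. \<psi> x + - m * \<rho> x)"
      by (rule test_function_add[OF \<psi> m\<rho>])
    moreover have "(LINT x:Ipi|lebesgue. \<psi> x + - m * \<rho> x) = 0"
      using \<rho>(2) by (subst set_integral_add(2)[OF int1[OF \<psi>] int1[OF m\<rho>]], subst set_integral_mult_right)
        (simp add: m_def)
    ultimately obtain \<zeta> where \<zeta>: "test_function \<zeta>" "derivative \<zeta> = (\<lambda>x. \<psi> x + - m * \<rho> x)"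
      by (rule test_function_primitive)
    have G\<psi>: "set_integrable lebesgue Ipi (\<lambda>x. G x * \<psi> x)" "set_integrable lebesgue Ipi (\<lambda>x. G x * \<rho> x)"
      by (intro set_integrable_mult_test_function G \<psi> \<rho>)+
    have "0 = (LINT x:Ipi|lebesgue. G x * \<psi> x - m * (G x * \<rho> x))"
      using zero[OF \<zeta>(1)] fun_cong[OF \<zeta>(2)] by (simp add: algebra_simps)
    also have "\<dots> = (LINT x:Ipi|lebesgue. G x * \<psi> x) - m * (LINT x:Ipi|lebesgue. G x * \<rho> x)"
      using G\<psi> by (subst set_integral_diff) auto
    also have "\<dots> = (LINT x:Ipi|lebesgue. G x * \<psi> x) - c * (LINT x:Ipi|lebesgue. \<psi> x)"
      by (simp add: m_def c_def)
    also have "\<dots> = (LINT x:Ipi|lebesgue. (G x - c) * \<psi> x)"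
      using G\<psi> int1[OF \<psi>] by (simp add: left_diff_distrib)
    finally show "(LINT x:Ipi|lebesgue. (G x - c) * \<psi> x) = 0"
      by simp
  qed
  then show ?thesis
    using that by simp
qed

section \<open>Testing the eigenvalue equation with the eigenfunction\<close>

text \<open>Local integrability gives measurability on compact subintervals only; the cut-offs to an
  exhausting sequence are eventually constant at each point, so their limit is measurable.\<close>

lemma locally_integrable_measurable:
  assumes "locally_integrable k"
  shows "(\<lambda>x. indicator Ipi x *\<^sub>R k x) \<in> borel_measurable lebesgue"
proof (rule borel_measurable_LIMSEQ_metric)
  let ?K = "\<lambda>n. {inverse (real (Suc n))..pi - inverse (real (Suc n))}"
  fix n
  have "0 < inverse (real (Suc n))"
    by simp
  then have "?K n \<subseteq> Ipi"
    unfolding subset_iff atLeastAtMost_iff greaterThanLessThan_iff by linarith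
  then have "set_integrable lebesgue (?K n) k"
    using assms by (auto simp: locally_integrable_def)
  then show "(\<lambda>x. indicator (?K n) x *\<^sub>R k x) \<in> borel_measurable lebesgue"
    by (auto simp: set_integrable_def)
next
  let ?K = "\<lambda>n. {inverse (real (Suc n))..pi - inverse (real (Suc n))}"
  fix x
  have "eventually (\<lambda>n. x \<in> ?K n \<longleftrightarrow> x \<in> Ipi) sequentially"
  proof (cases "x \<in> Ipi")
    case True
    then have "0 < min x (pi - x)"
      by auto
    with LIMSEQ_inverse_real_of_nat have "eventually (\<lambda>n. inverse (real (Suc n)) < min x (pi - x)) sequentially"
      by (rule order_tendstoD)
    then show ?thesis
      by eventually_elim (use True in auto)
  next
    case False
    have "x \<notin> ?K n" for n
    proof
      assume "x \<in> ?K n"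
      moreover have "0 < inverse (real (Suc n))"
        by simp
      ultimately have "x \<in> Ipi"
        unfolding atLeastAtMost_iff greaterThanLessThan_iff by linarith
      with False show False ..
    qed
    with False show ?thesis
      by (intro always_eventually allI) blast
  qed
  then show "(\<lambda>n. indicator (?K n) x *\<^sub>R k x) \<longlonglongrightarrow> indicator Ipi x *\<^sub>R k x"
    by (intro tendsto_eventually) (auto elim!: eventually_mono simp: indicator_def)
qed

text \<open>A non-integrable function has integral 0 by convention, so the sign survives in that
  case too and the zeroth-order term can be handled by its sign alone.\<close>

lemma Re_set_integral_nonneg:
  fixes f :: "real \<Rightarrow> complex"
  assumes "\<And>x. x \<in> A \<Longrightarrow> 0 \<le> Re (f x)"
  shows "0 \<le> Re (LINT x:A|M. f x)"
proof (cases "set_integrable M A f")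
  case True
  then have "Re (LINT x:A|M. f x) = (LINT x|M. Re (indicator A x *\<^sub>R f x))"
    unfolding set_lebesgue_integral_def set_integrable_def by (rule integral_Re[symmetric])
  also have "\<dots> \<ge> 0"
    using assms by (intro Bochner_Integration.integral_nonneg) (auto split: split_indicator)
  finally show ?thesis .
next
  case False
  then show ?thesis
    by (simp add: set_lebesgue_integral_def set_integrable_def not_integrable_integral_eq)
qed

section \<open>Behaviour at the end point and the energy estimate\<close>

lemma constant_zero_if_weighted_integrable:
  fixes c :: complex
  assumes F: "set_integrable lebesgue Ipi F"
    and nonneg: "\<And>x. x \<in> Ipi \<Longrightarrow> 0 \<le> F x"
    and bound: "AE x in lebesgue. x \<in> Ipi \<longrightarrow> (cmod c)\<^sup>2 / sin x ^ 3 \<le> F x"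
  shows "c = 0"
proof (rule ccontr)
  assume "c \<noteq> 0"
  define C where "C = (cmod c)\<^sup>2"
  define I where "I = (LINT x:Ipi|lebesgue. F x)"
  have "C > 0"
    using \<open>c \<noteq> 0\<close> by (simp add: C_def)
  have "I \<ge> 0"
    unfolding I_def set_lebesgue_integral_def using nonneg
    by (intro Bochner_Integration.integral_nonneg) (auto split: split_indicator)
  \<comment> \<open>On \<open>{0<..<e}\<close> one has \<open>sin x <= x <= e\<close>, so
    \<open>F\<close> is at least \<open>C / e^3\<close> almost everywhere there; times the length
    \<open>e\<close> this is \<open>C / e^2\<close>, which is at most \<open>I\<close>. Small
    \<open>e\<close> then gives a contradiction.\<close>
  have C_le: "C \<le> I * e\<^sup>2" if e: "0 < e" "e \<le> 1" for e
  proof -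
    have "e < pi"
      using e pi_gt3 by simp
    then have sub: "{0<..<e} \<subseteq> Ipi"
      by auto
    have Fe: "set_integrable lebesgue {0<..<e} F"
      using F sub by (intro set_integrable_subset[OF F]) auto
    have const: "set_integrable lebesgue {0<..<e} (\<lambda>_. C / e ^ 3)"
      by (intro absolutely_integrable_on_const) (auto simp: lmeasurable_open)
    have "C / e\<^sup>2 = (LINT x:{0<..<e}|lebesgue. C / e ^ 3)"
      using e by (simp add: set_lebesgue_integral_def divide_simps power2_eq_square power3_eq_cube)
    also have "\<dots> \<le> (LINT x:{0<..<e}|lebesgue. F x)"
    proof (rule set_integral_mono_AE[OF const Fe])
      show "AE x\<in>{0<..<e} in lebesgue. C / e ^ 3 \<le> F x"
        using bound
      proof eventually_elim
        case (elim x)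
        show ?case
        proof
          assume x: "x \<in> {0<..<e}"
          then have "0 < sin x" "sin x \<le> e"
            using sub sin_gt_zero[of x] sin_x_le_x[of x] by auto
          then have "C / e ^ 3 \<le> C / sin x ^ 3"
            using \<open>C > 0\<close> by (intro divide_left_mono power_mono) auto
          also have "\<dots> \<le> F x"
            using elim x sub by (auto simp: C_def)
          finally show "C / e ^ 3 \<le> F x" .
        qed
      qed
    qed
    also have "\<dots> \<le> I"
      unfolding I_def set_lebesgue_integral_def
      using F Fe sub nonneg
      by (intro integral_mono) (auto simp: set_integrable_def split: split_indicator)
    finally show ?thesis
      using e by (simp add: divide_simps split: if_splits)
  qed
  \<comment> \<open>The bound \<open>e <= 1\<close> gives \<open>e^2 <= e\<close>, and
    \<open>e <= C / (I + 1)\<close> makes \<open>I e < C\<close>; the added 1 keeps the quotient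
    meaningful for \<open>I = 0\<close>.\<close>
  define e where "e = min 1 (C / (I + 1))"
  have e: "0 < e" "e \<le> 1"
    using \<open>C > 0\<close> \<open>I \<ge> 0\<close> by (auto simp: e_def)
  have "C \<le> I * e\<^sup>2"
    using e by (rule C_le)
  also have "\<dots> \<le> I * e"
    using e \<open>I \<ge> 0\<close> by (intro mult_left_mono) (auto simp: power2_eq_square mult_left_le)
  also have "\<dots> \<le> I * (C / (I + 1))"
    using \<open>I \<ge> 0\<close> by (intro mult_left_mono) (auto simp: e_def)
  also have "\<dots> < C"
    using \<open>C > 0\<close> \<open>I \<ge> 0\<close> by (simp add: divide_simps)
  finally show False
    by simp
qed

text \<open>Bounds the density of the derivative term by that of the \<open>X1\<close> norm, since
  \<open>(g sin)' = h sin + g cos\<close>. The factor 2 comes from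
  \<open>(p + q)^2 <= 2 (p^2 + q^2)\<close>, and \<open>(a + 1)^2\<close> from
  \<open>a - cos x <= a + 1\<close>.\<close>

lemma weighted_derivative_bound:
  fixes h g :: complex
  assumes a: "a > 1" and x: "x \<in> Ipi"
  shows "(cmod (h * of_real (sin x) + g * of_real (cos x)))\<^sup>2 * ((a - cos x)\<^sup>2 / sin x)
    \<le> 2 * (a + 1)\<^sup>2 * (((cmod h)\<^sup>2 + (cmod g)\<^sup>2 / (sin x)\<^sup>2) * sin x)"
proof -
  have s: "0 < sin x"
    using x by (auto intro: sin_gt_zero)
  have "cmod (h * of_real (sin x) + g * of_real (cos x)) \<le> cmod h * sin x + cmod g"
  proof -
    have "cmod (h * of_real (sin x)) + cmod (g * of_real (cos x)) \<le> cmod h * sin x + cmod g"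
      using s by (simp add: norm_mult mult_left_le)
    then show ?thesis
      using norm_triangle_ineq order_trans by blast
  qed
  then have "(cmod (h * of_real (sin x) + g * of_real (cos x)))\<^sup>2 \<le> (cmod h * sin x + cmod g)\<^sup>2"
    by (intro power_mono) auto
  also have "\<dots> \<le> 2 * ((cmod h * sin x)\<^sup>2 + (cmod g)\<^sup>2)"
    using sum_squares_bound[of "cmod h * sin x" "cmod g"] by (simp add: power2_sum)
  finally have 1: "(cmod (h * of_real (sin x) + g * of_real (cos x)))\<^sup>2 \<le> 2 * ((cmod h * sin x)\<^sup>2 + (cmod g)\<^sup>2)" .
  have "(a - cos x)\<^sup>2 \<le> (a + 1)\<^sup>2"
    using a cos_le_one[of x] cos_ge_minus_one[of x] by (intro power_mono) linarith+
  then have 2: "(a - cos x)\<^sup>2 / sin x \<le> (a + 1)\<^sup>2 / sin x"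
    using s by (intro divide_right_mono) auto
  have "(cmod (h * of_real (sin x) + g * of_real (cos x)))\<^sup>2 * ((a - cos x)\<^sup>2 / sin x)
      \<le> (2 * ((cmod h * sin x)\<^sup>2 + (cmod g)\<^sup>2)) * ((a + 1)\<^sup>2 / sin x)"
    using s by (intro mult_mono 1 2) auto
  also have "\<dots> = 2 * (a + 1)\<^sup>2 * (((cmod h)\<^sup>2 + (cmod g)\<^sup>2 / (sin x)\<^sup>2) * sin x)"
    using s by (simp add: field_simps power2_eq_square)
  finally show ?thesis .
qed

lemma not_eigenvalue_M_if_Re_zero:
  assumes a: "a > 1" and \<mu>: "Re \<mu> = 0"
  shows "\<not> eigenvalue_M a \<sigma> n \<mu>"
proof
  assume "eigenvalue_M a \<sigma> n \<mu>"
  then obtain g where g: "g \<in> X1" "\<not> (AE x in lebesgue. x \<in> Ipi \<longrightarrow> g x = 0)"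
    and eq: "\<And>f. f \<in> X1 \<Longrightarrow> M_op a \<sigma> n g f = \<mu> * inner_X0 a g f"
    unfolding eigenvalue_M_def by blast
  define F where "F h x = ((cmod (h x))\<^sup>2 + (cmod (g x))\<^sup>2 / (sin x)\<^sup>2) * sin x" for h :: "real \<Rightarrow> complex" and x
  obtain h where gh: "has_weak_derivative g h" and F: "set_integrable lebesgue Ipi (F h)"
    using g(1) unfolding X1_def F_def by blast
  have s: "0 < sin x" if "x \<in> Ipi" for x
    using that by (auto intro: sin_gt_zero)
  define w where "w x = (a - cos x)\<^sup>2 / sin x" for x
  have w: "0 < w x" if "x \<in> Ipi" for x
  proof -
    have "0 < a - cos x"
      using a cos_le_one[of x] by linarith
    with s[OF that] show ?thesis
      by (simp add: w_def)
  qed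
  define G where "G x = g x * of_real (sin x)" for x
  define k where "k x = h x * of_real (sin x) + g x * of_real (cos x)" for x
  have "vector_derivative (\<lambda>x. complex_of_real (sin x)) (at x) = of_real (cos x)" for x
    by (intro vector_derivative_at has_vector_derivative_of_real DERIV_sin)
  with has_weak_derivative_mult[OF gh smooth_sin] have Gk: "has_weak_derivative G k"
    by (simp add: G_def[abs_def] k_def[abs_def])
  note Gk' = has_weak_derivativeD[OF Gk]
  have cG: "(\<lambda>x. cnj (g x) * of_real (sin x)) = (\<lambda>x. cnj (G x))"
    by (simp add: G_def)

  \<comment> \<open>Integrability is essential: for a non-integrable function the integral would be
    0 by convention and would not force \<open>k\<close> to vanish.\<close>
  have kw: "set_integrable lebesgue Ipi (\<lambda>x. (cmod (k x))\<^sup>2 * w x)"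
  proof (rule set_integrable_bound)
    show "set_integrable lebesgue Ipi (\<lambda>x. 2 * (a + 1)\<^sup>2 * F h x)"
      using F by (rule set_integrable_mult_right)
    have "w \<in> borel_measurable borel"
      unfolding w_def[abs_def] by measurable
    then have [measurable]: "w \<in> borel_measurable lebesgue"
      by (simp add: measurable_completion)
    note [measurable] = locally_integrable_measurable[OF Gk'(2)]
    \<comment> \<open>The indicator is put inside the modulus because measurability is available for
      the cut-off of \<open>k\<close> to \<open>Ipi\<close>, not for \<open>k\<close> on the whole
      line.\<close>
    have "(\<lambda>x. (cmod (indicator Ipi x *\<^sub>R k x))\<^sup>2 * w x) \<in> borel_measurable lebesgue"
      by measurable
    moreover have "(\<lambda>x. (cmod (indicator Ipi x *\<^sub>R k x))\<^sup>2 * w x) =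
        (\<lambda>x. indicator Ipi x *\<^sub>R ((cmod (k x))\<^sup>2 * w x))"
      by (auto split: split_indicator)
    ultimately show "set_borel_measurable lebesgue Ipi (\<lambda>x. (cmod (k x))\<^sup>2 * w x)"
      by (simp add: set_borel_measurable_def)
    show "AE x in lebesgue. x \<in> Ipi \<longrightarrow> norm ((cmod (k x))\<^sup>2 * w x) \<le> norm (2 * (a + 1)\<^sup>2 * F h x)"
    proof (intro AE_I2 impI)
      fix x assume x: "x \<in> Ipi"
      have "0 \<le> F h x"
        using s[OF x] by (simp add: F_def)
      then show "norm ((cmod (k x))\<^sup>2 * w x) \<le> norm (2 * (a + 1)\<^sup>2 * F h x)"
        using weighted_derivative_bound[OF a x, of "h x" "g x"] w[OF x] s[OF x]
        by (simp add: k_def w_def F_def abs_mult)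
    qed
  qed
  have first: "(LINT x:Ipi|lebesgue. weak_derivative (\<lambda>x. g x * of_real (sin x)) x *
      weak_derivative (\<lambda>x. cnj (g x) * of_real (sin x)) x * of_real ((a - cos x)\<^sup>2 / sin x))
    = of_real (LINT x:Ipi|lebesgue. (cmod (k x))\<^sup>2 * w x)" (is "?T1 = _")
  proof -
    have int: "set_integrable lebesgue Ipi (\<lambda>x. complex_of_real ((cmod (k x))\<^sup>2 * w x))"
      using kw unfolding set_integrable_def
      by (subst (asm) complex_of_real_integrable_eq[symmetric]) (simp add: scaleR_conv_of_real)
    \<comment> \<open>The two chosen representatives agree almost everywhere with \<open>k\<close>
      and its conjugate, whose product is the squared modulus.\<close>
    have "AE x in lebesgue. x \<in> Ipi \<longrightarrow> weak_derivative G x * weak_derivative (\<lambda>x. cnj (G x)) x *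
        of_real (w x) = of_real ((cmod (k x))\<^sup>2 * w x)"
      using weak_derivative_eq[OF Gk] weak_derivative_eq[OF has_weak_derivative_cnj[OF Gk]]
      by eventually_elim (auto simp: complex_norm_square simp del: of_real_power)
    from set_integral_cong_AE_lebesgue[OF int this] show ?thesis
      unfolding cG set_integral_complex_of_real by (simp add: G_def[abs_def] w_def)
  qed
  have second: "0 \<le> Re (inner_X0 a (\<lambda>x. of_real ((of_int n * \<sigma>)\<^sup>2) * g x
      + \<i> * of_real (of_int n * \<sigma> * (U_tau a x + 1)) * g x) g)" (is "0 \<le> Re ?T2")
    unfolding inner_X0_def
  proof (rule Re_set_integral_nonneg)
    fix x assume x: "x \<in> Ipi"
    define r t where "r = (of_int n * \<sigma>)\<^sup>2" and "t = of_int n * \<sigma> * (U_tau a x + 1)"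
    have z: "(of_real r * g x + \<i> * of_real t * g x) * cnj (g x) * of_real ((a - cos x)\<^sup>2 * sin x)
        = (of_real r + \<i> * of_real t) * of_real ((cmod (g x))\<^sup>2 * ((a - cos x)\<^sup>2 * sin x))"
      by (simp add: complex_norm_square algebra_simps del: of_real_power)
    have "0 \<le> r * ((cmod (g x))\<^sup>2 * ((a - cos x)\<^sup>2 * sin x))"
      using s[OF x] by (simp add: r_def)
    then show "0 \<le> Re ((of_real ((of_int n * \<sigma>)\<^sup>2) * g x
      + \<i> * of_real (of_int n * \<sigma> * (U_tau a x + 1)) * g x) * cnj (g x) * of_real ((a - cos x)\<^sup>2 * sin x))"
      unfolding r_def[symmetric] t_def[symmetric] z by simp
  qed
  \<comment> \<open>Only realness matters here; the passage from complex to real integrals holds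
    without any integrability.\<close>
  have third: "inner_X0 a g g = of_real (LINT x:Ipi|lebesgue. (cmod (g x))\<^sup>2 * ((a - cos x)\<^sup>2 * sin x))"
    unfolding inner_X0_def set_integral_complex_of_real[symmetric]
    by (simp add: complex_norm_square del: of_real_power)

  have "?T1 + ?T2 = \<mu> * inner_X0 a g g"
    using eq[OF g(1)] unfolding M_op_def .
  then have "Re (?T1 + ?T2) = 0"
    using \<mu> by (simp add: third)
  then have "(LINT x:Ipi|lebesgue. (cmod (k x))\<^sup>2 * w x) + Re ?T2 = 0"
    unfolding first by simp
  moreover have nonneg: "0 \<le> indicator Ipi x *\<^sub>R ((cmod (k x))\<^sup>2 * w x)" for x
    using w[of x] by (auto split: split_indicator)
  then have "0 \<le> (LINT x:Ipi|lebesgue. (cmod (k x))\<^sup>2 * w x)"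
    unfolding set_lebesgue_integral_def by (intro Bochner_Integration.integral_nonneg)
  ultimately have "(LINT x:Ipi|lebesgue. (cmod (k x))\<^sup>2 * w x) = 0"
    using second by linarith
  then have "AE x in lebesgue. indicator Ipi x *\<^sub>R ((cmod (k x))\<^sup>2 * w x) = 0"
    using integral_nonneg_eq_0_iff_AE[of lebesgue "\<lambda>x. indicator Ipi x *\<^sub>R ((cmod (k x))\<^sup>2 * w x)"] kw nonneg
    by (simp add: set_lebesgue_integral_def set_integrable_def)
  then have k0: "AE x in lebesgue. x \<in> Ipi \<longrightarrow> k x = 0"
    by eventually_elim (use w in force)
  obtain c where c: "AE x in lebesgue. x \<in> Ipi \<longrightarrow> G x = c"
  proof (rule constant_if_weak_derivative_zero[OF Gk'(1)])
    fix \<psi> assume \<psi>: "test_function \<psi>"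
    have "(LINT x:Ipi|lebesgue. k x * \<psi> x) = (LINT x:Ipi|lebesgue. 0)"
      using k0 by (intro set_integral_cong_AE_lebesgue) (auto simp: set_integrable_def)
    with Gk'(3)[OF \<psi>] show "(LINT x:Ipi|lebesgue. G x * derivative \<psi> x) = 0"
      by simp
  qed
  have "c = 0"
  proof (rule constant_zero_if_weighted_integrable[OF F])
    show "0 \<le> F h x" if "x \<in> Ipi" for x
      using s[OF that] by (simp add: F_def)
    show "AE x in lebesgue. x \<in> Ipi \<longrightarrow> (cmod c)\<^sup>2 / sin x ^ 3 \<le> F h x"
      using c
    proof eventually_elim
      case (elim x)
      show ?case
      proof
        assume x: "x \<in> Ipi"
        with elim have "c = g x * of_real (sin x)"
          by (simp add: G_def)
        then have "(cmod c)\<^sup>2 / sin x ^ 3 = (cmod (g x))\<^sup>2 / (sin x)\<^sup>2 * sin x"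
          using s[OF x] by (simp add: norm_mult power_mult_distrib field_simps power2_eq_square power3_eq_cube)
        also have "\<dots> \<le> F h x"
          using s[OF x] by (simp add: F_def algebra_simps)
        finally show "(cmod c)\<^sup>2 / sin x ^ 3 \<le> F h x" .
      qed
    qed
  qed
  from c have "AE x in lebesgue. x \<in> Ipi \<longrightarrow> g x = 0"
    by eventually_elim (use s \<open>c = 0\<close> in \<open>force simp: G_def\<close>)
  with g(2) show False ..
qed

theorem theorem4p1:
  fixes a \<sigma> :: real and n :: int and \<mu> :: complex
  assumes "a > 1" and "\<sigma> > 0"
    and "\<mu> = 0 \<or> Re \<mu> = 0"
  shows "\<not> eigenvalue_M a \<sigma> n \<mu>"
  using assms not_eigenvalue_M_if_Re_zero by auto

end
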